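(* Let $\mathcal C$ be a regular perfect curve defined by an irreducible polynomial $f\in\mathbb R[x,y]$ of degree $d$, such that $(0:1:0)$ is not an infinity point of $\mathcal C$, and write $f=f_d+f_{d-1}+\cdots+f_0$ with $f_i$ homogeneous of degree $i$. Then the asymptotic behavior of $\mathcal C$ is completely determined by $f_d$ and $f_{d-1}$. That is: if $\mathcal C$ and $\overline{\mathcal C}$ are two such curves of the same degree $d$, defined by $f$ and $\overline f$ respectively, with $f_d=\overline f_d$ and $f_{d-1}=\overline f_{d-1}$, then the series $r(z)$ and $\overline r(z)$ giving their (unique) infinity branches have, up to conjugation, the same terms with non-negative exponent.
   Context: Curves. A plane curve over $\mathbb C$ is the zero set in $\mathbb C^2$ of an irreducible polynomial $f$ of degree $d\ge 1$. Write $f=f_d+f_{d-1}+\cdots+f_0$ with $f_i$ homogeneous of degree $i$, and $F(x,y,z)=f_d+zf_{d-1}+\cdots+z^df_0$ for the polynomial of its projective closure. The infinity points are the points $(a:b:0)$ with $f_d(a,b)=0$. A regular perfect curve is a curve having a unique infinity point, which is regular (a non-singular point of the projective closure). Such a curve has a unique infinity branch. Infinity branches. Let $\mathcal C$ be a curve and $(1:m:0)$, $m\in\mathbb C$, an infinity point. Put $g(y,z)=F(1,y,z)$. Let $\varphi(z)=m+a_1z^{N_1/N}+a_2z^{N_2/N}+\cdots$ (finitely or infinitely many terms, $a_i\ne0$, $N,N_i\in\mathbb N$, $0<N_1<N_2<\cdots$) be a Puiseux series with $g(\varphi(z),z)=0$ and ramification index $N$ (the least common denominator of its exponents). Its conjugates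 are $\varphi_j(z)=m+a_1c_j^{N_1}z^{N_1/N}+a_2c_j^{N_2}z^{N_2/N}+\cdots$, where $c_1,\dots,c_N$ are the $N$-th roots of unity. Put $r_j(z)=z\varphi_j(z^{-1})=mz+a_1c_j^{N_1}z^{1-N_1/N}+a_2c_j^{N_2}z^{1-N_2/N}+\cdots$, which converges for $|z|>M$ for some $M>0$. The set $B=\bigcup_{j=1}^N L_j$, with leaves $L_j=\{(z,r_j(z))\in\mathbb C^2: |z|>M\}$, is an infinity branch of $\mathcal C$ associated to $(1:m:0)$. It is determined, up to conjugation (passing from one $r_j$ to another), by any one series $r=r_j$, and one says that $B$ is given by $r$. The asymptotic behavior of a curve with a unique infinity branch given by $r(z)$ is described by the terms with non-negative exponent in $r(z)$ (up to conjugation). *)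

theory Defs
  imports "HOL-Computational_Algebra.Computational_Algebra" "HOL-Analysis.Analysis"
begin

text \<open>
  A polynomial in \<open>R[x,y]\<close> is an element of \<open>R[x][y]\<close>: the inner variable is \<open>x\<close>, the outer one
  \<open>y\<close>. In general the variables of a nested polynomial are listed from the innermost outwards.
\<close>

definition bcoeff :: "'a::zero poly poly \<Rightarrow> nat \<Rightarrow> nat \<Rightarrow> 'a" where
  "bcoeff f i j = coeff (coeff f j) i"

definition eval2 :: "'a::comm_semiring_1 poly poly \<Rightarrow> 'a \<Rightarrow> 'a \<Rightarrow> 'a" where
  "eval2 f a b = poly (poly f [:b:]) a"

definition eval3 :: "'a::comm_semiring_1 poly poly poly \<Rightarrow> 'a \<Rightarrow> 'a \<Rightarrow> 'a \<Rightarrow> 'a" where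
  "eval3 F a b c = eval2 (poly F [:[:c:]:]) a b"

text \<open>Meaningful for nonzero polynomials only.\<close>

definition total_degree :: "'a::zero poly poly \<Rightarrow> nat" where
  "total_degree f = Max {i + j | i j. bcoeff f i j \<noteq> 0}"

definition hom_part :: "nat \<Rightarrow> 'a::comm_monoid_add poly poly \<Rightarrow> 'a poly poly" where
  "hom_part k f = (\<Sum>i\<le>k. monom (monom (bcoeff f i (k - i)) i) (k - i))"

text \<open>\<open>F(x,y,z) = f\<^sub>d + z f\<^sub>d\<^sub>-\<^sub>1 + \<dots> + z\<^sup>d f\<^sub>0\<close>, an element of \<open>R[x][y][z]\<close>.\<close>

definition proj_closure :: "'a::comm_monoid_add poly poly \<Rightarrow> 'a poly poly poly" where
  "proj_closure f = (\<Sum>k\<le>total_degree f. monom (hom_part (total_degree f - k) f) k)"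

definition complexify :: "real poly poly \<Rightarrow> complex poly poly" where
  "complexify f = map_poly (map_poly complex_of_real) f"


section \<open>Infinity points and regular perfect curves\<close>

text \<open>\<open>infinity_point f a b\<close>: the point \<open>(a:b:0)\<close> is an infinity point of the curve defined by \<open>f\<close>.\<close>

definition infinity_point :: "complex poly poly \<Rightarrow> complex \<Rightarrow> complex \<Rightarrow> bool" where
  "infinity_point f a b \<longleftrightarrow> (a, b) \<noteq> (0, 0) \<and> eval2 (hom_part (total_degree f) f) a b = 0"

text \<open>The three conjuncts are the partial derivatives with respect to \<open>x\<close>, \<open>y\<close> and \<open>z\<close>.\<close>

definition singular_point :: "complex poly poly poly \<Rightarrow> complex \<Rightarrow> complex \<Rightarrow> complex \<Rightarrow> bool" where
  "singular_point F a b c \<longleftrightarrow> eval3 F a b c = 0 \<and>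
     eval3 (map_poly (map_poly pderiv) F) a b c = 0 \<and>
     eval3 (map_poly pderiv F) a b c = 0 \<and>
     eval3 (pderiv F) a b c = 0"

text \<open>
  Irreducibility of \<open>f\<close> is not part of this predicate. For \<open>f\<close> irreducible over the reals, it
  implies irreducibility over the complex numbers: two complex factors would both pass through
  the only infinity point, which would then be singular.
\<close>

definition regular_perfect :: "complex poly poly \<Rightarrow> bool" where
  "regular_perfect f \<longleftrightarrow> (\<exists>a b. infinity_point f a b \<and>
     (\<forall>a' b'. infinity_point f a' b' \<longrightarrow> (\<exists>k. k \<noteq> 0 \<and> a' = k * a \<and> b' = k * b)) \<and>
     \<not> singular_point (proj_closure f) a b 0)"


section \<open>Puiseux series\<close>

text \<open>A series is given by its coefficients: \<open>\<phi> q\<close> is the coefficient of \<open>z\<^sup>q\<close>.\<close>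

definition puiseux :: "(rat \<Rightarrow> complex) \<Rightarrow> bool" where
  "puiseux \<phi> \<longleftrightarrow> (\<forall>q. \<phi> q \<noteq> 0 \<longrightarrow> q \<ge> 0) \<and>
     (\<exists>N::nat. N > 0 \<and> (\<forall>q. \<phi> q \<noteq> 0 \<longrightarrow> of_nat N * q \<in> \<int>))"

definition ramification_index :: "(rat \<Rightarrow> complex) \<Rightarrow> nat" where
  "ramification_index \<phi> = (LEAST N. N > 0 \<and> (\<forall>q. \<phi> q \<noteq> 0 \<longrightarrow> of_nat N * q \<in> \<int>))"

text \<open>The power series \<open>\<phi>(t\<^sup>N)\<close>, where \<open>N\<close> is the ramification index.\<close>

definition puiseux_fps :: "(rat \<Rightarrow> complex) \<Rightarrow> complex fps" where
  "puiseux_fps \<phi> = Abs_fps (\<lambda>n. \<phi> (of_nat n / of_nat (ramification_index \<phi>)))"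

text \<open>The conjugate belonging to \<open>c\<close> with \<open>c\<^sup>N = 1\<close>: the coefficient of \<open>z\<^sup>n\<^sup>/\<^sup>N\<close> is multiplied by \<open>c\<^sup>n\<close>.\<close>

definition puiseux_conj :: "complex \<Rightarrow> (rat \<Rightarrow> complex) \<Rightarrow> rat \<Rightarrow> complex" where
  "puiseux_conj c \<phi> q = c powi \<lfloor>of_nat (ramification_index \<phi>) * q\<rfloor> * \<phi> q"

definition conjugate :: "(rat \<Rightarrow> complex) \<Rightarrow> (rat \<Rightarrow> complex) \<Rightarrow> bool" where
  "conjugate \<phi> \<psi> \<longleftrightarrow> (\<exists>c. c ^ ramification_index \<phi> = 1 \<and> \<psi> = puiseux_conj c \<phi>)"


section \<open>Infinity branches\<close>

text \<open>\<open>g(y,z) = F(1,y,z)\<close>, an element of \<open>\<complex>[y][z]\<close>.\<close>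

definition affine_at_infinity :: "complex poly poly \<Rightarrow> complex poly poly" where
  "affine_at_infinity f = map_poly (map_poly (\<lambda>p. poly p 1)) (proj_closure f)"

text \<open>
  The last conjunct is \<open>g(\<phi>(z), z) = 0\<close>; substituting \<open>z = t\<^sup>N\<close> makes it an identity of power
  series in \<open>t\<close>.
\<close>

definition infinity_series :: "complex poly poly \<Rightarrow> complex \<Rightarrow> (rat \<Rightarrow> complex) \<Rightarrow> bool" where
  "infinity_series f m \<phi> \<longleftrightarrow> infinity_point f 1 m \<and> puiseux \<phi> \<and> \<phi> 0 = m \<and>
     eval2 (map_poly (map_poly fps_const) (affine_at_infinity f))
       (puiseux_fps \<phi>) (fps_X ^ ramification_index \<phi>) = 0"

text \<open>The coefficients of \<open>r(z) = z \<phi>(z\<^sup>-\<^sup>1)\<close>: that of \<open>z\<^sup>q\<close> in \<open>r\<close> is that of \<open>z\<^sup>1\<^sup>-\<^sup>q\<close> in \<open>\<phi>\<close>.\<close>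

definition branch_series :: "(rat \<Rightarrow> complex) \<Rightarrow> rat \<Rightarrow> complex" where
  "branch_series \<phi> q = \<phi> (1 - q)"

text \<open>The \<open>n\<close>-th term of \<open>r(z)\<close>, with the principal value of the fractional power.\<close>

definition branch_term :: "(rat \<Rightarrow> complex) \<Rightarrow> complex \<Rightarrow> nat \<Rightarrow> complex" where
  "branch_term \<phi> z n =
     (let N = ramification_index \<phi>
      in branch_series \<phi> (1 - of_nat n / of_nat N) * z powr (1 - of_nat n / of_nat N))"

definition leaf :: "(rat \<Rightarrow> complex) \<Rightarrow> real \<Rightarrow> (complex \<times> complex) set" where
  "leaf \<phi> M = {(z, \<Sum>n. branch_term \<phi> z n) | z. norm z > M}"

text \<open>
  \<open>infinity_branch f \<phi> B\<close>: \<open>B\<close> is an infinity branch of the curve defined by \<open>f\<close>, and it is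
  given by \<open>r = branch_series \<phi>\<close>.
\<close>

definition infinity_branch ::
    "complex poly poly \<Rightarrow> (rat \<Rightarrow> complex) \<Rightarrow> (complex \<times> complex) set \<Rightarrow> bool" where
  "infinity_branch f \<phi> B \<longleftrightarrow> (\<exists>m. infinity_series f m \<phi>) \<and>
     (\<exists>M>0. (\<forall>\<psi> z. conjugate \<phi> \<psi> \<longrightarrow> norm z > M \<longrightarrow> summable (branch_term \<psi> z)) \<and>
            B = (\<Union>\<psi>\<in>{\<psi>. conjugate \<phi> \<psi>}. leaf \<psi> M))"

end

theory Submission imports Defs begin

text \<open>
  Since \<open>(1:m:0)\<close> is the only infinity point, \<open>F(1,y,z) = c (y-m)\<^sup>d + z h(y) + z\<^sup>2 (\<dots>)\<close>, where \<open>c\<close> and \<open>m\<close>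
  come from \<open>f\<^sub>d\<close> and \<open>h\<close> from \<open>f\<^sub>d\<^sub>-\<^sub>1\<close>; for \<open>d \<ge> 2\<close> regularity means \<open>h(m) \<noteq> 0\<close>. Hence
  \<open>U = \<phi>(t\<^sup>K) - m\<close> satisfies \<open>c U\<^sup>d + t\<^sup>K S = 0\<close> with \<open>S(0) = h(m)\<close>, so \<open>U\<close> has order \<open>K/d\<close> and its
  leading coefficient is determined up to a \<open>d\<close>-th root of unity, which conjugation absorbs.
  If \<open>U\<close> and \<open>U'\<close> belong to the two curves and have the same leading coefficient, then \<open>S - S'\<close> is a
  multiple of \<open>U - U'\<close> modulo \<open>t\<^sup>K\<close>. Dividing \<open>U\<close> and \<open>U'\<close> by \<open>t\<^sup>K\<^sup>/\<^sup>d\<close> and subtracting the equations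
  shows \<open>U \<equiv> U'\<close> modulo \<open>t\<close> to the power \<open>K + K/d\<close>, so the terms of \<open>\<phi>\<close> and \<open>\<phi>'\<close> with exponent at most \<open>1\<close>
  agree.
\<close>

unbundle no vec_syntax

section \<open>Power series roots\<close>

text \<open>Scalars are embedded as constant series, in the same syntactic form that the
  coefficients of the polynomial in \<open>infinity_series\<close> have, so the lemmas apply to that
  equation directly.\<close>

abbreviation fps_eval :: "'a::comm_ring_1 poly \<Rightarrow> 'a fps \<Rightarrow> 'a fps" where
  "fps_eval p \<equiv> poly (map_poly fps_const p)"

lemma fps_eval_pCons [simp]: "fps_eval (pCons a p) \<Phi> = fps_const a + \<Phi> * fps_eval p \<Phi>"
  by (simp add: map_poly_pCons)

lemma fps_eval_add: "fps_eval (p + q) \<Phi> = fps_eval p \<Phi> + fps_eval q \<Phi>"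
  by (induction p q rule: poly_induct2)
     (simp_all add: algebra_simps flip: fps_const_add)

lemma fps_eval_smult: "fps_eval (smult a p) \<Phi> = fps_const a * fps_eval p \<Phi>"
  by (induction p) (simp_all add: algebra_simps flip: fps_const_mult)

lemma fps_eval_mult: "fps_eval (p * q) \<Phi> = fps_eval p \<Phi> * fps_eval q \<Phi>"
  by (induction p) (simp_all add: algebra_simps fps_eval_add fps_eval_smult)

lemma fps_eval_power: "fps_eval (p ^ n) \<Phi> = fps_eval p \<Phi> ^ n"
  by (induction n) (simp_all add: fps_eval_mult map_poly_1)

lemma fps_eval_nth_0: "fps_eval p \<Phi> $ 0 = poly p (\<Phi> $ 0)"
  by (induction p) simp_all

text \<open>Substituting a series without constant term is a ring homomorphism that fixes
  constants.\<close>

lemma fps_eval_compose: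
  fixes p :: "'a::idom poly"
  assumes "\<Psi> $ 0 = 0"
  shows "fps_eval p \<Phi> oo \<Psi> = fps_eval p (\<Phi> oo \<Psi>)"
  by (induction p) (simp_all add: fps_compose_add_distrib fps_compose_mult_distrib assms)

text \<open>Induction along Horner's scheme. Applied to the polynomial \<open>h\<close>, it shows
  that replacing one root by another changes \<open>S\<close> by a multiple of their difference, up
  to higher terms.\<close>

lemma diff_dvd_poly_diff: "x - y dvd poly p x - poly p (y::'a::comm_ring_1)"
proof (induction p)
  case (pCons a p)
  have "poly (pCons a p) x - poly (pCons a p) y = (x - y) * poly p x + y * (poly p x - poly p y)"
    by (simp add: algebra_simps)
  with pCons.IH show ?case by simp
qed simp

section \<open>Roots of \<open>c U^d + t^K S = 0\<close> with \<open>S(0)\<close> nonzero\<close>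

text \<open>As \<open>S\<close> is a unit, \<open>t^K S\<close> has order exactly \<open>K\<close>;
  comparing orders and lowest coefficients with those of \<open>c U^d\<close> gives both
  claims.\<close>

lemma root_leading_term:
  fixes U S :: "'a::field fps"
  assumes eq: "fps_const c * U ^ d + fps_X ^ K * S = 0" and "c \<noteq> 0" and "S $ 0 \<noteq> 0" and "d > 0"
  shows "d * subdegree U = K" "c * (U $ subdegree U) ^ d = - (S $ 0)"
proof -
  have eq': "fps_const c * U ^ d = - (fps_X ^ K * S)"
    using eq by (simp add: eq_neg_iff_add_eq_0)
  have S: "S \<noteq> 0" "subdegree S = 0" using \<open>S $ 0 \<noteq> 0\<close> by auto
  then have "fps_const c * U ^ d \<noteq> 0" unfolding eq' by simp
  then have "U ^ d \<noteq> 0" by auto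
  then have "subdegree (fps_const c * U ^ d) = d * subdegree U"
    using \<open>c \<noteq> 0\<close> by simp
  moreover have "subdegree (- (fps_X ^ K * S)) = K"
    using S by (simp add: subdegree_uminus)
  ultimately show *: "d * subdegree U = K" using eq' by simp
  have "(fps_const c * U ^ d) $ (d * subdegree U) = c * (U $ subdegree U) ^ d"
    by simp
  then show "c * (U $ subdegree U) ^ d = - (S $ 0)"
    using eq' * by (simp add: fps_X_power_mult_nth)
qed

text \<open>A Hensel-type uniqueness argument. With \<open>U = t^s V\<close> and
  \<open>U' = t^s V'\<close>, where \<open>d s = K\<close>, the factor \<open>t^K\<close> cancels
  from both equations. Their difference is \<open>V - V'\<close> times a unit plus
  \<open>t^K T\<close>; the term with \<open>W\<close> acquires a factor \<open>t^s\<close> and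
  cannot spoil the unit.\<close>

lemma root_determined_by_leading_term:
  fixes U U' S S' T :: "'a::field_char_0 fps"
  assumes eq: "fps_const c * U ^ d + fps_X ^ K * S = 0"
    and eq': "fps_const c * U' ^ d + fps_X ^ K * S' = 0"
    and "c \<noteq> 0" "S $ 0 \<noteq> 0" "S' $ 0 \<noteq> 0" "d > 0" "K > 0"
    and diff: "S - S' = (U - U') * W + fps_X ^ K * T"
    and same: "U $ subdegree U = U' $ subdegree U"
    and "n \<le> K"
  shows "U $ n = U' $ n"
proof -
  define s where "s = subdegree U"
  have K: "d * s = K" using root_leading_term(1)[OF eq] assms by (simp add: s_def)
  moreover have "d * subdegree U' = K" using root_leading_term(1)[OF eq'] assms by simp
  ultimately have s': "subdegree U' = s" using \<open>d > 0\<close> by (metis mult_cancel1 not_gr_zero)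
  have "s > 0" using K \<open>K > 0\<close> by (cases s) auto
  define V where "V = fps_shift s U"
  define V' where "V' = fps_shift s U'"
  have U: "U = fps_X ^ s * V" "U' = fps_X ^ s * V'"
    using subdegree_decompose[of U] subdegree_decompose[of U'] s'
    by (simp_all add: V_def V'_def s_def mult.commute)
  have V0: "V $ 0 = V' $ 0" using same by (simp add: V_def V'_def s_def)
  have "U \<noteq> 0" using \<open>s > 0\<close> s_def by auto
  then have "V $ 0 \<noteq> 0" by (simp add: V_def s_def)
  have XK: "(fps_X ^ s) ^ d = (fps_X ^ K :: 'a fps)" using K by (metis mult.commute power_mult)
  have "fps_X ^ K * (fps_const c * V ^ d + S) = 0"
    using eq by (simp add: U power_mult_distrib XK algebra_simps)
  moreover have "fps_X ^ K * (fps_const c * V' ^ d + S') = 0"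
    using eq' by (simp add: U power_mult_distrib XK algebra_simps)
  ultimately have 0: "fps_const c * V ^ d + S = 0" "fps_const c * V' ^ d + S' = 0" by auto
  \<comment> \<open>\<open>Q\<close> is the cofactor in
    \<open>V^d - V'^d = (V - V') Q\<close>.\<close>
  define Q where "Q = (\<Sum>i<d. V' ^ (d - Suc i) * V ^ i)"
  have "(V - V') * (fps_const c * Q + fps_X ^ s * W) + fps_X ^ K * T
      = fps_const c * (V ^ d - V' ^ d) + (S - S')"
    unfolding diff power_diff_sumr2 U Q_def by (simp add: algebra_simps)
  also have "\<dots> = 0" proof -
    have "S = - (fps_const c * V ^ d)" "S' = - (fps_const c * V' ^ d)"
      using 0 by (simp_all add: eq_neg_iff_add_eq_0 add.commute)
    then show ?thesis by (simp add: algebra_simps)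
  qed
  finally have "(V - V') * (fps_const c * Q + fps_X ^ s * W) = fps_X ^ K * (- T)"
    by (simp add: eq_neg_iff_add_eq_0)
  then have "fps_X ^ K dvd (V - V') * (fps_const c * Q + fps_X ^ s * W)" by simp
  moreover have "is_unit (fps_const c * Q + fps_X ^ s * W)"
  proof -
    \<comment> \<open>Since \<open>V(0) = V'(0)\<close>, all \<open>d\<close> summands have the same
      constant term, so \<open>Q(0) = d V(0)^(d-1)\<close>, which is nonzero in characteristic
      0.\<close>
    have "Q $ 0 = (\<Sum>i<d. (V $ 0) ^ (d - 1))"
      unfolding Q_def fps_sum_nth
      by (intro sum.cong refl) (simp add: fps_power_zeroth V0 flip: power_add)
    then show ?thesis
      using \<open>s > 0\<close> \<open>c \<noteq> 0\<close> \<open>V $ 0 \<noteq> 0\<close> \<open>d > 0\<close> by (simp add: fps_X_power_mult_nth)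
  qed
  ultimately have "fps_X ^ K dvd V - V'" by (simp only: dvd_mult_unit_iff)
  then obtain Y where Y: "V - V' = fps_X ^ K * Y" by (elim dvdE)
  have "U - U' = fps_X ^ (s + K) * Y"
    by (simp add: U power_add mult.assoc flip: Y) (simp add: algebra_simps)
  \<comment> \<open>The agreement reaches up to \<open>K + s - 1\<close>. Because
    \<open>s > 0\<close>, this includes \<open>n = K\<close>, the exponent 1 of
    \<open>\<phi>\<close> and hence the constant term of \<open>r\<close>.\<close>
  then have "(U - U') $ n = 0"
    using \<open>n \<le> K\<close> \<open>s > 0\<close> by (simp add: fps_X_power_mult_nth)
  then show ?thesis by simp
qed

section \<open>Homogeneous parts and the projective closure\<close>

lemma pderiv_sum: "pderiv (sum p A) = (\<Sum>x\<in>A. pderiv (p x))"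
  for p :: "'b \<Rightarrow> 'a::idom poly"
  by (induction A rule: infinite_finite_induct) (simp_all add: pderiv_add)

lemma eval2_altdef:
  assumes "degree g \<le> n"
  shows "eval2 g a b = (\<Sum>k\<le>n. poly (coeff g k) a * b ^ k)"
proof -
  have "(\<Sum>k\<le>degree g. poly (coeff g k) a * b ^ k) = (\<Sum>k\<le>n. poly (coeff g k) a * b ^ k)"
    using assms by (intro sum.mono_neutral_left) (auto simp: coeff_eq_0)
  then show ?thesis
    by (simp add: eval2_def poly_altdef[of g] poly_sum poly_power)
qed

lemma bcoeff_hom_part: "bcoeff (hom_part k f) i j = (if i + j = k then bcoeff f i j else 0)"
proof -
  have "bcoeff (hom_part k f) i j
      = (\<Sum>l\<le>k. if l = i \<and> k - l = j then bcoeff f l (k - l) else 0)"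
    by (simp add: bcoeff_def hom_part_def coeff_sum if_distrib cong: if_cong)
       (intro sum.cong, auto)
  also have "\<dots> = (\<Sum>l\<le>k. if l = i then (if i + j = k then bcoeff f i j else 0) else 0)"
    by (intro sum.cong) auto
  finally show ?thesis by auto
qed

lemma poly_poly_eqI: "(\<And>i j. bcoeff f i j = bcoeff g i j) \<Longrightarrow> f = g"
  by (simp add: bcoeff_def poly_eq_iff)

lemma bcoeff_complexify: "bcoeff (complexify f) i j = of_real (bcoeff f i j)"
  by (simp add: bcoeff_def complexify_def coeff_map_poly)

lemma total_degree_complexify: "total_degree (complexify f) = total_degree f"
  by (simp add: total_degree_def bcoeff_complexify)

lemma hom_part_complexify: "hom_part k (complexify f) = complexify (hom_part k f)"
  by (rule poly_poly_eqI) (simp add: bcoeff_complexify bcoeff_hom_part)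

lemma coeff_proj_closure:
  "coeff (proj_closure f) k = (if k \<le> total_degree f then hom_part (total_degree f - k) f else 0)"
  by (simp add: proj_closure_def coeff_sum)

lemma eval3_at_0: "eval3 F a b 0 = eval2 (coeff F 0) a b"
  by (simp add: eval3_def poly_0_coeff_0)

lemma eval2_hom_part:
  "eval2 (hom_part k f) a b = (\<Sum>i\<le>k. bcoeff f i (k - i) * a ^ i * b ^ (k - i))"
  by (simp add: eval2_def hom_part_def poly_sum poly_monom poly_power algebra_simps)

text \<open>The inner variable is \<open>x\<close>, so the derivative acts on coefficients. The
  truncated exponent \<open>i - 1\<close> at \<open>i = 0\<close> is harmless because of the factor
  \<open>of_nat i\<close>.\<close>

lemma eval2_dx_hom_part:
  fixes f :: "'a::idom poly poly"
  shows "eval2 (map_poly pderiv (hom_part k f)) a b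
    = (\<Sum>i\<le>k. of_nat i * bcoeff f i (k - i) * a ^ (i - 1) * b ^ (k - i))"
proof -
  have "map_poly pderiv (hom_part k f)
      = (\<Sum>i\<le>k. monom (monom (of_nat i * bcoeff f i (k - i)) (i - 1)) (k - i))"
    by (rule poly_eqI)
       (simp add: hom_part_def coeff_map_poly coeff_sum pderiv_sum if_distrib pderiv_monom
             cong: if_cong)
  then show ?thesis
    by (simp add: eval2_def poly_sum poly_monom poly_power algebra_simps)
qed

lemma eval2_dy_hom_part:
  fixes f :: "'a::idom poly poly"
  shows "eval2 (pderiv (hom_part k f)) a b
    = (\<Sum>i\<le>k. of_nat (k - i) * bcoeff f i (k - i) * a ^ i * b ^ (k - i - 1))"
  by (simp add: eval2_def hom_part_def pderiv_sum pderiv_monom poly_sum poly_monom poly_power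
        algebra_simps)


section \<open>The expansion of \<open>F(1,y,z)\<close> in powers of \<open>z\<close>\<close>

text \<open>For \<open>k \<le> total_degree f\<close> this is the coefficient
  \<open>f_{d-k}(1,y)\<close> of \<open>z^k\<close> in \<open>F(1,y,z)\<close>; in particular
  \<open>k = 1\<close> gives \<open>h\<close>. For larger \<open>k\<close> the subtraction
  truncates, so sums stop at the total degree.\<close>

definition infinity_coeff :: "complex poly poly \<Rightarrow> nat \<Rightarrow> complex poly" where
  "infinity_coeff f k = map_poly (\<lambda>p. poly p 1) (hom_part (total_degree f - k) f)"

lemma poly_map_poly_eval: "poly (map_poly (\<lambda>p. poly p a) f) b = eval2 f a b"
  by (induction f) (simp_all add: map_poly_pCons eval2_def)

lemma coeff_hom_part: "coeff (hom_part k f) j = (if j \<le> k then monom (bcoeff f (k - j) j) (k - j) else 0)"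
proof (rule poly_eqI)
  fix i
  have "coeff (coeff (hom_part k f) j) i = (if i + j = k then bcoeff f i j else 0)"
    using bcoeff_hom_part[of k f i j] by (simp add: bcoeff_def)
  also have "\<dots> = coeff (if j \<le> k then monom (bcoeff f (k - j) j) (k - j) else 0) i"
    by auto
  finally show "coeff (coeff (hom_part k f) j) i
      = coeff (if j \<le> k then monom (bcoeff f (k - j) j) (k - j) else 0) i" .
qed

lemma coeff_infinity_coeff:
  "coeff (infinity_coeff f k) j = (if j \<le> total_degree f - k then bcoeff f (total_degree f - k - j) j else 0)"
  by (simp add: infinity_coeff_def coeff_map_poly coeff_hom_part poly_monom)

lemma coeff_affine_at_infinity:
  "coeff (affine_at_infinity f) k = (if k \<le> total_degree f then infinity_coeff f k else 0)"
  by (simp add: affine_at_infinity_def coeff_map_poly coeff_proj_closure infinity_coeff_def)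

lemma infinity_series_eq:
  assumes "infinity_series f m \<phi>"
  shows "(\<Sum>k\<le>total_degree f. fps_eval (infinity_coeff f k) (puiseux_fps \<phi>)
           * fps_X ^ (ramification_index \<phi> * k)) = 0"
proof -
  let ?G = "map_poly (map_poly fps_const) (affine_at_infinity f)"
  have coeff_G: "coeff ?G k = (if k \<le> total_degree f then map_poly fps_const (infinity_coeff f k) else 0)" for k
    by (simp add: coeff_map_poly coeff_affine_at_infinity)
  have "degree ?G \<le> total_degree f"
    by (rule degree_le) (simp add: coeff_G)
  from eval2_altdef[OF this] assms show ?thesis
    by (simp add: infinity_series_def coeff_G power_mult)
qed

lemma poly_infinity_coeff: "poly (infinity_coeff f k) y = eval2 (hom_part (total_degree f - k) f) 1 y"
  by (simp add: infinity_coeff_def poly_map_poly_eval)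

lemma infinity_point_iff_root:
  "infinity_point f 1 y \<longleftrightarrow> poly (infinity_coeff f 0) y = 0"
  by (simp add: infinity_point_def poly_infinity_coeff)

section \<open>Homogeneity and Euler's identity\<close>

lemma eval2_hom_part_scale:
  "eval2 (hom_part k f) (a * x) (a * y) = a ^ k * eval2 (hom_part k f) x y"
proof -
  have "a ^ k = a ^ i * a ^ (k - i)" if "i \<le> k" for i
    using that by (simp flip: power_add)
  then show ?thesis
    unfolding eval2_hom_part sum_distrib_left
    by (intro sum.cong refl) (simp add: power_mult_distrib ac_simps)
qed

text \<open>Euler's identity, checked monomial by monomial. Where \<open>a\<close> is nonzero, it
  yields the vanishing of the \<open>x\<close>-derivative from that of the form and its
  \<open>y\<close>-derivative.\<close>

lemma euler_hom_part:
  fixes f :: "'a::idom poly poly"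
  shows "a * eval2 (map_poly pderiv (hom_part k f)) a b + b * eval2 (pderiv (hom_part k f)) a b
    = of_nat k * eval2 (hom_part k f) a b"
  unfolding eval2_hom_part eval2_dx_hom_part eval2_dy_hom_part sum_distrib_left
    sum.distrib[symmetric]
proof (intro sum.cong refl)
  fix i assume "i \<in> {..k}"
  then obtain j where k: "k = i + j" by (auto simp: le_iff_add)
  have A: "a * (of_nat i * a ^ (i - 1)) = of_nat i * a ^ i"
    by (cases i) (simp_all add: algebra_simps)
  have B: "b * (of_nat j * b ^ (j - 1)) = of_nat j * b ^ j"
    by (cases j) (simp_all add: algebra_simps)
  have C: "a * (of_nat i * bcoeff f i (k - i) * a ^ (i - 1) * b ^ (k - i)) +
        b * (of_nat (k - i) * bcoeff f i (k - i) * a ^ i * b ^ (k - i - 1))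
      = bcoeff f i j * ((a * (of_nat i * a ^ (i - 1))) * b ^ j + a ^ i * (b * (of_nat j * b ^ (j - 1))))"
    by (simp add: k algebra_simps)
  show "a * (of_nat i * bcoeff f i (k - i) * a ^ (i - 1) * b ^ (k - i)) +
        b * (of_nat (k - i) * bcoeff f i (k - i) * a ^ i * b ^ (k - i - 1))
      = of_nat k * (bcoeff f i (k - i) * a ^ i * b ^ (k - i))"
    unfolding C A B by (simp add: k algebra_simps)
qed

text \<open>The summand \<open>i = k\<close> vanishes; for \<open>i < k\<close> the exponents of
  \<open>a\<close> add up to \<open>k - 1\<close>.\<close>

lemma eval2_dy_scale:
  fixes f :: "'a::idom poly poly"
  shows "eval2 (pderiv (hom_part k f)) (a * x) (a * y) = a ^ (k - 1) * eval2 (pderiv (hom_part k f)) x y"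
  unfolding eval2_dy_hom_part sum_distrib_left
proof (intro sum.cong refl)
  fix i assume "i \<in> {..k}"
  then consider "i = k" | j where "k = Suc (i + j)"
    by (metis atMost_iff le_neq_implies_less less_iff_Suc_add)
  then show "of_nat (k - i) * bcoeff f i (k - i) * (a * x) ^ i * (a * y) ^ (k - i - 1)
      = a ^ (k - 1) * (of_nat (k - i) * bcoeff f i (k - i) * x ^ i * y ^ (k - i - 1))"
    by cases (simp_all add: power_mult_distrib power_add algebra_simps)
qed

section \<open>Consequences of a unique, regular infinity point\<close>

text \<open>The value \<open>f_d(0,1)\<close> is the coefficient of \<open>y^d\<close>, so
  \<open>f_d(1,y)\<close> has degree exactly \<open>d\<close>. Its only complex root is
  \<open>m\<close>, so it splits as a multiple of \<open>(y-m)^d\<close>, and having a root it is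
  not constant.\<close>

lemma infinity_coeff_0_eq:
  assumes "\<not> infinity_point f 0 1" and "infinity_point f 1 m"
    and unique: "\<And>y. infinity_point f 1 y \<Longrightarrow> y = m"
  obtains c where "c \<noteq> 0" "infinity_coeff f 0 = smult c ([:-m, 1:] ^ total_degree f)" "total_degree f > 0"
proof -
  let ?P = "infinity_coeff f 0" and ?d = "total_degree f"
  have "bcoeff f 0 ?d \<noteq> 0"
  proof -
    have "eval2 (hom_part ?d f) 0 1 = (\<Sum>i\<le>?d. if i = 0 then bcoeff f 0 ?d else 0)"
      unfolding eval2_hom_part by (intro sum.cong) auto
    then show ?thesis using assms(1) by (simp add: infinity_point_def)
  qed
  then have nz: "coeff ?P ?d \<noteq> 0" by (simp add: coeff_infinity_coeff)
  moreover have "degree ?P \<le> ?d" by (rule degree_le) (simp add: coeff_infinity_coeff)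
  ultimately have deg: "degree ?P = ?d" by (intro order_antisym le_degree)
  have "poly ?P z = 0 \<longleftrightarrow> z = m" for z
    using assms(2) unique[of z] unfolding infinity_point_iff_root by blast
  then have P: "?P = smult (lead_coeff ?P) ([:-m, 1:] ^ order m ?P)"
    using complex_poly_decompose[of ?P] by simp
  have lc: "lead_coeff ?P \<noteq> 0" using nz by auto
  have "degree ?P = order m ?P"
    using lc by (subst P) (simp add: degree_power_eq)
  with P deg have eq: "?P = smult (lead_coeff ?P) ([:-m, 1:] ^ ?d)" by simp
  have "?d > 0"
  proof (rule ccontr)
    assume "\<not> ?d > 0"
    then have "poly ?P m = lead_coeff ?P" by (subst eq) simp
    then show False using lc assms(2) by (simp add: infinity_point_iff_root)
  qed
  from that[OF lc eq this] show ?thesis .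
qed

lemma regular_perfect_unique:
  assumes "regular_perfect f" "infinity_point f 1 m" "infinity_point f 1 m'"
  shows "m' = m"
proof -
  from assms(1) obtain a b where ab: "\<And>a' b'. infinity_point f a' b' \<Longrightarrow> \<exists>k. k \<noteq> 0 \<and> a' = k * a \<and> b' = k * b"
    unfolding regular_perfect_def by blast
  from ab[OF assms(2)] ab[OF assms(3)] obtain k k'
    where k: "1 = k * a" "m = k * b" "1 = k' * a" "m' = k' * b" by blast
  then have "a \<noteq> 0" by auto
  with k have "k = k'" by (metis mult_right_cancel)
  with k show ?thesis by simp
qed

text \<open>If \<open>h(m) = 0\<close>, all partial derivatives of \<open>F\<close> vanish at
  \<open>(1:m:0)\<close>: the one in \<open>y\<close> because \<open>m\<close> is a multiple root of
  \<open>f_d(1,y)\<close>, the one in \<open>x\<close> by Euler's identity, and the one in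
  \<open>z\<close> because it equals \<open>f_{d-1}(1,m) = h(m)\<close>.\<close>

lemma infinity_coeff_1_nonzero:
  assumes reg: "regular_perfect f" and m: "infinity_point f 1 m"
    and P: "infinity_coeff f 0 = smult c ([:-m, 1:] ^ total_degree f)"
    and d: "total_degree f \<ge> 2"
  shows "poly (infinity_coeff f 1) m \<noteq> 0"
proof
  assume root: "poly (infinity_coeff f 1) m = 0"
  let ?d = "total_degree f"
  from reg obtain a b where ab: "infinity_point f a b"
      "\<And>a' b'. infinity_point f a' b' \<Longrightarrow> \<exists>k. k \<noteq> 0 \<and> a' = k * a \<and> b' = k * b"
    and ns: "\<not> singular_point (proj_closure f) a b 0"
    unfolding regular_perfect_def by blast
  from ab(2)[OF m] obtain k where k: "1 = k * a" "m = k * b" by blast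
  then have "a \<noteq> 0" by auto
  \<comment> \<open>Regularity is stated for some representative \<open>(a, b)\<close> of the point;
    being \<open>a\<close> times \<open>(1, m)\<close>, it inherits the vanishing by
    homogeneity.\<close>
  have "a * m = (k * a) * b" using k(2) by simp
  then have b: "b = a * m" using k(1) by simp
  have 0: "eval2 (hom_part ?d f) a b = 0" using ab(1) by (simp add: infinity_point_def)
  have "pderiv (infinity_coeff f 0) = map_poly (\<lambda>p. poly p 1) (pderiv (hom_part ?d f))"
    by (rule poly_eqI) (simp add: infinity_coeff_def coeff_pderiv coeff_map_poly flip: of_nat_Suc)
  then have "eval2 (pderiv (hom_part ?d f)) 1 m = poly (pderiv (infinity_coeff f 0)) m"
    by (simp add: poly_map_poly_eval)
  also have "\<dots> = 0"
    using d by (simp add: P pderiv_smult pderiv_power)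
  finally have dy: "eval2 (pderiv (hom_part ?d f)) a b = 0"
    using eval2_dy_scale[of ?d f a 1 m] by (simp add: b)
  have dx: "eval2 (map_poly pderiv (hom_part ?d f)) a b = 0"
    using euler_hom_part[of a ?d f b] 0 dy \<open>a \<noteq> 0\<close> by simp
  have dz: "eval2 (hom_part (?d - 1) f) a b = 0"
    using eval2_hom_part_scale[of "?d - 1" f a 1 m] root by (simp add: b poly_infinity_coeff)
  have "singular_point (proj_closure f) a b 0"
    using 0 dx dy dz d
    by (simp add: singular_point_def eval3_at_0 coeff_map_poly coeff_proj_closure coeff_pderiv)
  with ns show False by contradiction
qed

section \<open>Puiseux series\<close>

lemma ramification_index:
  assumes "puiseux \<phi>"
  shows "ramification_index \<phi> > 0" "\<phi> q \<noteq> 0 \<Longrightarrow> of_nat (ramification_index \<phi>) * q \<in> \<int>"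
proof -
  have "\<exists>N::nat. N > 0 \<and> (\<forall>q. \<phi> q \<noteq> 0 \<longrightarrow> of_nat N * q \<in> \<int>)"
    using assms by (simp add: puiseux_def)
  from LeastI_ex[OF this]
  show "ramification_index \<phi> > 0" "\<phi> q \<noteq> 0 \<Longrightarrow> of_nat (ramification_index \<phi>) * q \<in> \<int>"
    by (auto simp: ramification_index_def)
qed

lemma puiseux_conj_1: "puiseux_conj 1 \<phi> = \<phi>"
  by (simp add: puiseux_conj_def fun_eq_iff)

lemma fps_compose_X_power_nth:
  fixes A :: "'a::idom fps"
  assumes "j > 0"
  shows "(A oo fps_X ^ j) $ n = (if j dvd n then A $ (n div j) else 0)"
proof -
  have "(A oo fps_X ^ j) $ n = (\<Sum>i=0..n. if i = n div j \<and> j dvd n then A $ i else 0)"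
    unfolding fps_compose_nth
    using assms by (intro sum.cong) (auto simp: power_mult[symmetric] fps_X_power_nth)
  also have "\<dots> = (\<Sum>i=0..n. if i = n div j then (if j dvd n then A $ i else 0) else 0)"
    by (intro sum.cong) auto
  finally show ?thesis by simp
qed

section \<open>Conjugation and refinement of the denominator as substitutions\<close>

text \<open>Conjugation is \<open>t \<mapsto> c t\<close>, and passing from denominator
  \<open>N\<close> to \<open>N j\<close> is \<open>t \<mapsto> t^j\<close>. The extra factor
  \<open>j\<close> lets two series with different ramification indices share a denominator.\<close>

lemma puiseux_conj_fps:
  assumes "puiseux \<phi>" and "j > 0"
  shows "Abs_fps (\<lambda>n. puiseux_conj c \<phi> (of_nat n / of_nat (ramification_index \<phi> * j)))
    = (puiseux_fps \<phi> oo fps_const c * fps_X) oo fps_X ^ j"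
proof (rule fps_ext)
  fix n
  let ?N = "ramification_index \<phi>"
  have N: "?N > 0" using ramification_index(1)[OF assms(1)] .
  show "Abs_fps (\<lambda>n. puiseux_conj c \<phi> (of_nat n / of_nat (?N * j))) $ n
      = ((puiseux_fps \<phi> oo fps_const c * fps_X) oo fps_X ^ j) $ n"
  proof (cases "j dvd n")
    case True
    then obtain l where l: "n = j * l" by (elim dvdE)
    then have q: "of_nat n / of_nat (?N * j) = (of_nat l / of_nat ?N :: rat)"
      using assms(2) by simp
    have "\<lfloor>of_nat ?N * (of_nat l / of_nat ?N :: rat)\<rfloor> = int l"
      using N by simp
    then show ?thesis
      using True l assms(2) N
      by (simp only: fps_nth_Abs_fps q puiseux_conj_def fps_compose_X_power_nth fps_nth_compose_linear)
         (simp add: puiseux_fps_def)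
  next
    case False
    \<comment> \<open>A nonzero coefficient would make \<open>N\<close> times its exponent, that is
      \<open>n / j\<close>, an integer.\<close>
    have "\<phi> (of_nat n / of_nat (?N * j)) = 0"
    proof (rule ccontr)
      assume "\<phi> (of_nat n / of_nat (?N * j)) \<noteq> 0"
      from ramification_index(2)[OF assms(1) this] have "of_nat n / of_nat j \<in> (\<int> :: rat set)"
        using N by simp
      then obtain z where "of_nat n / of_nat j = (of_int z :: rat)" by (elim Ints_cases)
      then have "(of_int (int n) :: rat) = of_int (z * int j)"
        using assms(2) by (simp add: field_simps)
      then have "int n = z * int j" by (simp only: of_int_eq_iff)
      then have "int j dvd int n" by simp
      then have "j dvd n" by (simp only: of_nat_dvd_iff)
      with False show False by contradiction
    qed
    with False assms(2) show ?thesis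
      by (simp add: puiseux_conj_def fps_compose_X_power_nth del: of_nat_mult)
  qed
qed

text \<open>Both substitutions preserve the equation of the curve: \<open>t^(N k)\<close> becomes
  \<open>c^(N k) t^(K k)\<close>, and \<open>c^N = 1\<close>.\<close>

lemma infinity_series_conj_eq:
  assumes \<phi>: "infinity_series f m \<phi>" and c: "c ^ ramification_index \<phi> = 1" and "j > 0"
    and K: "K = ramification_index \<phi> * j"
    and \<Phi>: "\<Phi> = Abs_fps (\<lambda>n. puiseux_conj c \<phi> (of_nat n / of_nat K))"
  shows "(\<Sum>k\<le>total_degree f. fps_eval (infinity_coeff f k) \<Phi> * fps_X ^ (K * k)) = 0"
proof -
  have p: "puiseux \<phi>" using \<phi> by (simp add: infinity_series_def)
  have comp: "\<Phi> = (puiseux_fps \<phi> oo fps_const c * fps_X) oo fps_X ^ j"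
    unfolding \<Phi> K using puiseux_conj_fps[OF p \<open>j > 0\<close>] .
  have X0: "(fps_X ^ j :: complex fps) $ 0 = 0" using \<open>j > 0\<close> by (simp add: fps_X_power_nth)
  have c0: "(fps_const c * fps_X) $ 0 = 0" by simp
  have X: "((fps_X ^ (ramification_index \<phi> * k)) oo fps_const c * fps_X) oo fps_X ^ j = fps_X ^ (K * k)" for k
  proof -
    let ?n = "ramification_index \<phi> * k"
    have "(fps_X ^ ?n) oo fps_const c * fps_X = (fps_const c * fps_X) ^ ?n"
      by (simp only: fps_compose_power[OF c0, symmetric] fps_X_fps_compose_startby0[OF c0])
    also have "\<dots> = fps_X ^ ?n"
      by (simp only: power_mult_distrib fps_const_power power_mult c power_one fps_const_1_eq_1 mult_1)
    finally have "((fps_X ^ ?n) oo fps_const c * fps_X) oo fps_X ^ j = (fps_X ^ j) ^ ?n"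
      by (simp only: fps_compose_power[OF X0, symmetric] fps_X_fps_compose_startby0[OF X0])
    then show ?thesis by (simp only: K flip: power_mult) (simp only: ac_simps)
  qed
  have "0 = ((\<Sum>k\<le>total_degree f. fps_eval (infinity_coeff f k) (puiseux_fps \<phi>)
           * fps_X ^ (ramification_index \<phi> * k)) oo fps_const c * fps_X) oo fps_X ^ j"
    by (simp add: infinity_series_eq[OF \<phi>])
  also have "\<dots> = (\<Sum>k\<le>total_degree f. fps_eval (infinity_coeff f k) \<Phi> * fps_X ^ (K * k))"
    by (simp only: fps_compose_sum_distrib fps_compose_mult_distrib[OF X0] fps_compose_mult_distrib[OF c0]
        fps_eval_compose[OF X0] fps_eval_compose[OF c0] X comp)
  finally show ?thesis by simp
qed

text \<open>Exponents \<open>q \<ge> 0\<close> of \<open>r\<close> correspond to exponents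
  \<open>1 - q \<le> 1\<close> of \<open>\<phi>\<close>. Both series are supported on nonnegative
  multiples of \<open>1/K\<close>, so finitely many comparisons suffice.\<close>

lemma branch_series_eqI:
  assumes \<phi>: "puiseux \<phi>" and \<phi>': "puiseux \<phi>'"
    and K: "K = ramification_index \<phi> * ramification_index \<phi>'"
    and eq: "\<And>n. n \<le> K \<Longrightarrow> puiseux_conj c \<phi> (of_nat n / of_nat K) = \<phi>' (of_nat n / of_nat K)"
  shows "\<forall>q\<ge>0. branch_series (puiseux_conj c \<phi>) q = branch_series \<phi>' q"
proof (intro allI impI)
  fix q :: rat assume "q \<ge> 0"
  define p where "p = 1 - q"
  have "p \<le> 1" using \<open>q \<ge> 0\<close> by (simp add: p_def)
  have "K > 0" using ramification_index(1)[OF \<phi>] ramification_index(1)[OF \<phi>'] by (simp add: K)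
  have "puiseux_conj c \<phi> p = \<phi>' p"
  proof (cases "\<phi> p = 0 \<and> \<phi>' p = 0")
    case True
    then show ?thesis by (simp add: puiseux_conj_def)
  next
    case False
    then have "p \<ge> 0" using \<phi> \<phi>' by (auto simp: puiseux_def)
    have "of_nat K * p \<in> \<int>"
    proof (cases "\<phi> p = 0")
      case True
      with False have "of_nat (ramification_index \<phi>) * (of_nat (ramification_index \<phi>') * p) \<in> \<int>"
        by (intro Ints_mult ramification_index(2)[OF \<phi>']) auto
      then show ?thesis by (simp add: K mult.assoc)
    next
      case False
      then have "of_nat (ramification_index \<phi>') * (of_nat (ramification_index \<phi>) * p) \<in> \<int>"
        by (intro Ints_mult ramification_index(2)[OF \<phi>]) auto
      then show ?thesis by (simp add: K ac_simps)
    qed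
    then obtain z where z: "of_nat K * p = of_int z" by (elim Ints_cases)
    have "of_int z \<ge> (0::rat)" using \<open>p \<ge> 0\<close> by (simp flip: z)
    then have "of_nat K * p = of_nat (nat z)" by (simp add: z)
    then have p: "p = of_nat (nat z) / of_nat K" using \<open>K > 0\<close> by (simp add: field_simps)
    have "nat z \<le> K" using \<open>p \<le> 1\<close> \<open>K > 0\<close> by (simp add: p)
    from eq[OF this] show ?thesis by (simp only: p)
  qed
  then show "branch_series (puiseux_conj c \<phi>) q = branch_series \<phi>' q"
    by (simp add: branch_series_def p_def)
qed

section \<open>Comparing infinity series\<close>

text \<open>Splits off the terms \<open>k = 0\<close> and \<open>k = 1\<close>, which come from
  \<open>f_d\<close> and \<open>f_{d-1}\<close>. All others carry a factor \<open>t^(2K)\<close> and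
  disappear into \<open>R\<close>; this is the shape \<open>c U^d + t^K S = 0\<close>.\<close>

lemma root_equation:
  assumes P: "infinity_coeff f 0 = smult c ([:-m, 1:] ^ total_degree f)" and d: "total_degree f = Suc (Suc e)"
    and eq: "(\<Sum>k\<le>total_degree f. fps_eval (infinity_coeff f k) \<Phi> * fps_X ^ (K * k)) = 0"
  obtains R where
    "fps_const c * (\<Phi> - fps_const m) ^ total_degree f
       + fps_X ^ K * (fps_eval (infinity_coeff f 1) \<Phi> + fps_X ^ K * R) = 0"
proof -
  define R where "R = (\<Sum>k\<le>e. fps_eval (infinity_coeff f (Suc (Suc k))) \<Phi> * fps_X ^ (K * k))"
  have P': "fps_eval (infinity_coeff f 0) \<Phi> = fps_const c * (\<Phi> - fps_const m) ^ total_degree f"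
    by (simp add: P fps_eval_smult fps_eval_power fps_const_neg[symmetric] del: fps_const_neg)
  have "(\<Sum>k\<le>total_degree f. fps_eval (infinity_coeff f k) \<Phi> * fps_X ^ (K * k))
      = fps_eval (infinity_coeff f 0) \<Phi>
        + fps_X ^ K * (fps_eval (infinity_coeff f 1) \<Phi> + fps_X ^ K * R)"
    unfolding d R_def sum.atMost_Suc_shift sum_distrib_left
    by (simp add: power_add algebra_simps sum_distrib_left)
  then show thesis using that[of R] eq by (simp add: P')
qed

lemma puiseux_conj_nth_0:
  "puiseux_conj c \<phi> 0 = \<phi> 0"
  by (simp add: puiseux_conj_def)

section \<open>Matching the leading terms by conjugation\<close>

text \<open>Applying \<open>root_leading_term\<close> with \<open>K\<close> the ramification index
  \<open>N\<close> shows that \<open>d\<close> divides \<open>N\<close> and that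
  \<open>\<phi> - m\<close> starts with the exponent \<open>s/N = 1/d\<close>.\<close>

lemma infinity_series_leading_term:
  assumes \<phi>: "infinity_series f m \<phi>"
    and P: "infinity_coeff f 0 = smult c ([:-m, 1:] ^ total_degree f)" and "c \<noteq> 0"
    and d: "total_degree f \<ge> 2" and P1: "poly (infinity_coeff f 1) m \<noteq> 0"
  obtains s where "s > 0" "ramification_index \<phi> = total_degree f * s"
    "c * \<phi> (1 / of_nat (total_degree f)) ^ total_degree f = - poly (infinity_coeff f 1) m"
proof -
  let ?d = "total_degree f" and ?N = "ramification_index \<phi>"
  define \<Phi> where "\<Phi> = puiseux_fps \<phi>"
  have p: "puiseux \<phi>" and \<phi>0: "\<phi> 0 = m" using \<phi> by (simp_all add: infinity_series_def)
  have N: "?N > 0" using ramification_index(1)[OF p] .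
  obtain e where e: "?d = Suc (Suc e)" using d by (auto simp: le_iff_add)
  obtain R where R: "fps_const c * (\<Phi> - fps_const m) ^ ?d
       + fps_X ^ ?N * (fps_eval (infinity_coeff f 1) \<Phi> + fps_X ^ ?N * R) = 0"
    by (rule root_equation[OF P e infinity_series_eq[OF \<phi>, folded \<Phi>_def]])
  define U where "U = \<Phi> - fps_const m"
  have "\<Phi> $ 0 = m" by (simp add: \<Phi>_def puiseux_fps_def \<phi>0)
  then have S: "(fps_eval (infinity_coeff f 1) \<Phi> + fps_X ^ ?N * R) $ 0 = poly (infinity_coeff f 1) m"
    using N by (simp add: fps_eval_nth_0)
  note lead = root_leading_term[OF R \<open>c \<noteq> 0\<close>, folded U_def]
  have s: "?d * subdegree U = ?N" using lead(1) P1 d S by simp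
  then have "subdegree U > 0" using N by (cases "subdegree U") auto
  have nth: "U $ n = \<phi> (of_nat n / of_nat ?N)" if "n > 0" for n
    using that by (simp add: U_def \<Phi>_def puiseux_fps_def)
  have "of_nat (subdegree U) / of_nat ?N = (1 / of_nat ?d :: rat)"
    using \<open>subdegree U > 0\<close> d by (simp add: s[symmetric])
  then have "c * \<phi> (1 / of_nat ?d) ^ ?d = - poly (infinity_coeff f 1) m"
    using lead(2) P1 d nth[OF \<open>subdegree U > 0\<close>] unfolding S by simp
  then show thesis
    using that[OF \<open>subdegree U > 0\<close> s[symmetric]] by blast
qed

text \<open>Conjugation by \<open>c\<close> multiplies the coefficient of \<open>z^(1/d)\<close> by
  \<open>c^s\<close>. Any \<open>s\<close>-th root \<open>c\<close> of the desired quotient works,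
  since the \<open>d\<close>-th power of that quotient is 1.\<close>

lemma conjugate_with_leading_term:
  assumes p: "puiseux \<phi>" and N: "ramification_index \<phi> = d * s" "s > 0" "d > 0"
    and eq: "\<phi> (1 / of_nat d) ^ d = x ^ d" and "x \<noteq> 0"
  obtains c where "c ^ ramification_index \<phi> = 1" "puiseux_conj c \<phi> (1 / of_nat d) = x"
proof -
  define \<alpha> where "\<alpha> = \<phi> (1 / of_nat d)"
  have "\<alpha> \<noteq> 0" using eq \<open>x \<noteq> 0\<close> \<open>d > 0\<close> by (auto simp: \<alpha>_def power_0_left)
  obtain c where c: "c ^ s = x / \<alpha>" using nth_root_exists[OF \<open>s > 0\<close>] by blast
  have "c ^ ramification_index \<phi> = (c ^ s) ^ d" by (simp add: N(1) mult.commute flip: power_mult)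
  also have "\<dots> = 1" using eq \<open>x \<noteq> 0\<close> by (simp add: c power_divide flip: \<alpha>_def)
  finally have 1: "c ^ ramification_index \<phi> = 1" .
  have "of_nat (ramification_index \<phi>) * (1 / of_nat d) = (of_nat s :: rat)"
    using \<open>d > 0\<close> by (simp add: N(1))
  then have "puiseux_conj c \<phi> (1 / of_nat d) = c ^ s * \<alpha>"
    by (simp only: puiseux_conj_def \<alpha>_def floor_of_nat power_int_of_nat)
  also have "\<dots> = x" using c \<open>\<alpha> \<noteq> 0\<close> by simp
  finally show thesis using that[OF 1] by simp
qed

text \<open>Once \<open>w\<close> has aligned the coefficients of \<open>z^(1/d)\<close>, both
  series, written over the common denominator \<open>K\<close>, satisfy equations with the same
  \<open>c\<close>, \<open>m\<close> and \<open>h\<close>, so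
  \<open>root_determined_by_leading_term\<close> applies.\<close>

lemma infinity_series_agree:
  fixes f f' :: "complex poly poly"
  assumes \<phi>: "infinity_series f m \<phi>" and \<phi>': "infinity_series f' m \<phi>'"
    and deg: "total_degree f' = total_degree f"
    and c: "c \<noteq> 0" "infinity_coeff f 0 = smult c ([:-m, 1:] ^ total_degree f)"
    and same: "infinity_coeff f' 0 = infinity_coeff f 0" "infinity_coeff f' 1 = infinity_coeff f 1"
    and d: "total_degree f \<ge> 2" and P1: "poly (infinity_coeff f 1) m \<noteq> 0"
  shows "\<exists>\<psi>. conjugate \<phi> \<psi> \<and> (\<forall>q\<ge>0. branch_series \<psi> q = branch_series \<phi>' q)"
proof -
  let ?d = "total_degree f"
  have p: "puiseux \<phi>" "\<phi> 0 = m" and p': "puiseux \<phi>'" "\<phi>' 0 = m"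
    using \<phi> \<phi>' by (simp_all add: infinity_series_def)
  have c': "infinity_coeff f' 0 = smult c ([:-m, 1:] ^ total_degree f')"
    using c same by (simp add: deg)
  obtain e where e: "?d = Suc (Suc e)" using d by (auto simp: le_iff_add)
  obtain s where s: "s > 0" "ramification_index \<phi> = ?d * s"
    "c * \<phi> (1 / of_nat ?d) ^ ?d = - poly (infinity_coeff f 1) m"
    by (rule infinity_series_leading_term[OF \<phi> c(2,1) d P1])
  obtain s' where s': "s' > 0" "ramification_index \<phi>' = ?d * s'"
    "c * \<phi>' (1 / of_nat ?d) ^ ?d = - poly (infinity_coeff f 1) m"
    by (rule infinity_series_leading_term[OF \<phi>' c' c(1), unfolded deg same, OF d P1])
  have "\<phi> (1 / of_nat ?d) ^ ?d = \<phi>' (1 / of_nat ?d) ^ ?d"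
    using s(3) s'(3) c(1) by (metis mult_left_cancel)
  moreover have "\<phi>' (1 / of_nat ?d) \<noteq> 0"
    using s'(3) P1 d by (auto simp: power_0_left)
  ultimately obtain w where w: "w ^ ramification_index \<phi> = 1"
      "puiseux_conj w \<phi> (1 / of_nat ?d) = \<phi>' (1 / of_nat ?d)"
    using conjugate_with_leading_term[OF p(1) s(2,1)] e by (metis zero_less_Suc)
  define K where "K = ramification_index \<phi> * ramification_index \<phi>'"
  have N: "ramification_index \<phi> > 0" "ramification_index \<phi>' > 0"
    using ramification_index(1) p(1) p'(1) by auto
  have "K > 0" using N by (simp add: K_def)
  define \<Phi> where "\<Phi> = Abs_fps (\<lambda>n. puiseux_conj w \<phi> (of_nat n / of_nat K))"
  define \<Phi>' where "\<Phi>' = Abs_fps (\<lambda>n. \<phi>' (of_nat n / of_nat K))"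
  have 0: "\<Phi> $ 0 = m" "\<Phi>' $ 0 = m"
    by (simp_all add: \<Phi>_def \<Phi>'_def puiseux_conj_nth_0 p p')
  define H where "H = fps_eval (infinity_coeff f 1)"
  obtain R where R: "fps_const c * (\<Phi> - fps_const m) ^ ?d + fps_X ^ K * (H \<Phi> + fps_X ^ K * R) = 0"
    unfolding H_def
    by (rule root_equation[OF c(2) e infinity_series_conj_eq[OF \<phi> w(1) N(2) K_def \<Phi>_def]])
  have K': "K = ramification_index \<phi>' * ramification_index \<phi>"
    by (simp add: K_def mult.commute)
  \<comment> \<open>Viewing \<open>\<phi>'\<close> as its own conjugate by 1 lets the same lemma
    rewrite its equation over the denominator \<open>K\<close>.\<close>
  have \<Phi>'_conj: "\<Phi>' = Abs_fps (\<lambda>n. puiseux_conj 1 \<phi>' (of_nat n / of_nat K))"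
    by (simp add: \<Phi>'_def puiseux_conj_1)
  obtain R' where R': "fps_const c * (\<Phi>' - fps_const m) ^ ?d + fps_X ^ K * (H \<Phi>' + fps_X ^ K * R') = 0"
    unfolding H_def
    by (rule root_equation[OF c' e[folded deg]
          infinity_series_conj_eq[OF \<phi>' power_one N(1) K' \<Phi>'_conj], unfolded deg same])
  have S: "(H \<Phi> + fps_X ^ K * R) $ 0 \<noteq> 0" "(H \<Phi>' + fps_X ^ K * R') $ 0 \<noteq> 0"
    using 0 P1 \<open>K > 0\<close> by (simp_all add: H_def fps_eval_nth_0)
  have "\<Phi> - \<Phi>' dvd H \<Phi> - H \<Phi>'"
    unfolding H_def by (rule diff_dvd_poly_diff)
  then obtain W where W: "H \<Phi> - H \<Phi>' = (\<Phi> - \<Phi>') * W" by (elim dvdE)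
  \<comment> \<open>The same \<open>H\<close> occurs for both curves because their
    \<open>f_{d-1}\<close> agree; the lower parts of the polynomials enter only through
    \<open>R\<close> and \<open>R'\<close>.\<close>
  have diff: "(H \<Phi> + fps_X ^ K * R) - (H \<Phi>' + fps_X ^ K * R')
      = ((\<Phi> - fps_const m) - (\<Phi>' - fps_const m)) * W + fps_X ^ K * (R - R')"
    using W by (simp add: algebra_simps)
  have sub: "?d * subdegree (\<Phi> - fps_const m) = K"
    using root_leading_term(1)[OF R c(1) S(1)] d by simp
  define t where "t = subdegree (\<Phi> - fps_const m)"
  have "t > 0" using sub \<open>K > 0\<close> by (cases t) (auto simp: t_def)
  \<comment> \<open>The order \<open>t = K/d\<close> is the exponent \<open>1/d\<close> over the
    denominator \<open>K\<close>, exactly where \<open>w\<close> made the coefficients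
    equal.\<close>
  moreover have "of_nat t / of_nat K = (1 / of_nat ?d :: rat)"
    using \<open>t > 0\<close> d by (simp add: t_def flip: sub)
  ultimately have lead: "(\<Phi> - fps_const m) $ t = (\<Phi>' - fps_const m) $ t"
    using w(2) by (simp add: \<Phi>_def \<Phi>'_def)
  have "\<Phi> $ n = \<Phi>' $ n" if "n \<le> K" for n
    using root_determined_by_leading_term[OF R R' c(1) S _ \<open>K > 0\<close> diff lead[unfolded t_def] that] d
    by simp
  then have "\<forall>q\<ge>0. branch_series (puiseux_conj w \<phi>) q = branch_series \<phi>' q"
    by (intro branch_series_eqI[OF p(1) p'(1) K_def]) (simp add: \<Phi>_def \<Phi>'_def)
  with w(1) show ?thesis by (auto simp: conjugate_def)
qed

text \<open>
  For \<open>d = 1\<close> the infinity point is regular even if \<open>h(m) = 0\<close>, so there need not be a leading term;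
  but then the equation is linear.
\<close>

lemma infinity_series_agree_linear:
  fixes f f' :: "complex poly poly"
  assumes \<phi>: "infinity_series f m \<phi>" and \<phi>': "infinity_series f' m \<phi>'"
    and deg: "total_degree f' = total_degree f"
    and c: "c \<noteq> 0" "infinity_coeff f 0 = smult c ([:-m, 1:] ^ total_degree f)"
    and same: "infinity_coeff f' 0 = infinity_coeff f 0" "infinity_coeff f' 1 = infinity_coeff f 1"
    and d: "total_degree f = 1"
  shows "\<exists>\<psi>. conjugate \<phi> \<psi> \<and> (\<forall>q\<ge>0. branch_series \<psi> q = branch_series \<phi>' q)"
proof -
  have p: "puiseux \<phi>" and p': "puiseux \<phi>'"
    using \<phi> \<phi>' by (simp_all add: infinity_series_def)
  define K where "K = ramification_index \<phi> * ramification_index \<phi>'"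
  define \<Phi> where "\<Phi> = Abs_fps (\<lambda>n. puiseux_conj 1 \<phi> (of_nat n / of_nat K))"
  define \<Phi>' where "\<Phi>' = Abs_fps (\<lambda>n. puiseux_conj 1 \<phi>' (of_nat n / of_nat K))"
  \<comment> \<open>Here \<open>f_{d-1} = f_0\<close> is a constant \<open>h\<close>, and both
    series solve \<open>c (\<Phi> - m) + h t^K = 0\<close>.\<close>
  have "degree (infinity_coeff f (Suc 0)) \<le> 0"
    by (rule degree_le) (simp add: coeff_infinity_coeff d)
  then obtain h where h: "infinity_coeff f (Suc 0) = [:h:]" by (auto elim: degree_eq_zeroE)
  have "fps_const c * (\<Phi> - fps_const m) + fps_const h * fps_X ^ K = 0"
    using infinity_series_conj_eq[OF \<phi> _ _ K_def \<Phi>_def] ramification_index(1)[OF p']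
    by (simp add: d c(2) h fps_eval_smult fps_const_neg[symmetric] algebra_simps del: fps_const_neg)
  moreover have "fps_const c * (\<Phi>' - fps_const m) + fps_const h * fps_X ^ K = 0"
    using infinity_series_conj_eq[OF \<phi>' _ _ _ \<Phi>'_def] ramification_index(1)[OF p]
    by (simp add: d deg same[unfolded One_nat_def] c(2) h K_def fps_eval_smult fps_const_neg[symmetric] algebra_simps
        del: fps_const_neg)
  ultimately have "fps_const c * (\<Phi> - fps_const m) = fps_const c * (\<Phi>' - fps_const m)"
    by (metis add_right_cancel)
  then have "\<Phi> = \<Phi>'" using c(1) by simp
  then have "\<forall>q\<ge>0. branch_series (puiseux_conj 1 \<phi>) q = branch_series \<phi>' q"
    by (intro branch_series_eqI[OF p p' K_def])
       (simp add: \<Phi>_def \<Phi>'_def fps_eq_iff puiseux_conj_1[of \<phi>'])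
  moreover have "conjugate \<phi> (puiseux_conj 1 \<phi>)" 
    unfolding conjugate_def using power_one by blast
  ultimately show ?thesis by blast
qed

section \<open>Passage to the complexified curves and the cases \<open>d = 1\<close> and
  \<open>d \<ge> 2\<close>\<close>

theorem theorem5p2:
  fixes f f' :: "real poly poly" and d :: nat
    and \<phi> \<phi>' :: "rat \<Rightarrow> complex" and B B' :: "(complex \<times> complex) set"
  assumes "irreducible f" and "irreducible f'"
    and "total_degree f = d" and "total_degree f' = d"
    and "regular_perfect (complexify f)" and "regular_perfect (complexify f')"
    and "\<not> infinity_point (complexify f) 0 1" and "\<not> infinity_point (complexify f') 0 1"
    and "hom_part d f = hom_part d f'"
    and "hom_part (d - 1) f = hom_part (d - 1) f'"
    and "infinity_branch (complexify f) \<phi> B"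
    and "infinity_branch (complexify f') \<phi>' B'"
  shows "\<exists>\<psi>. conjugate \<phi> \<psi> \<and> (\<forall>q\<ge>0. branch_series \<psi> q = branch_series \<phi>' q)"
proof -
  define g g' where "g = complexify f" and "g' = complexify f'"
  have deg: "total_degree g = d" "total_degree g' = d"
    using assms(3,4) by (simp_all add: g_def g'_def total_degree_complexify)
  have same: "infinity_coeff g' 0 = infinity_coeff g 0" "infinity_coeff g' 1 = infinity_coeff g 1"
    using assms(9,10) by (simp_all add: infinity_coeff_def deg) (simp_all add: g_def g'_def hom_part_complexify)
  have reg: "regular_perfect g" and not01: "\<not> infinity_point g 0 1"
    using assms(5,7) by (simp_all add: g_def)
  obtain m m' where \<phi>: "infinity_series g m \<phi>" and \<phi>': "infinity_series g' m' \<phi>'"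
    using assms(11,12) by (auto simp: infinity_branch_def g_def g'_def)
  \<comment> \<open>Infinity points depend on \<open>f_d\<close> alone, so \<open>m'\<close> also
    belongs to the first curve, and uniqueness there identifies it with \<open>m\<close>.\<close>
  have m: "infinity_point g 1 m" and "infinity_point g 1 m'"
    using \<phi> \<phi>' by (simp_all add: infinity_series_def infinity_point_iff_root same)
  then have "m' = m" using regular_perfect_unique[OF reg] by blast
  note \<phi>' = \<phi>'[unfolded this]
  obtain c where c: "c \<noteq> 0" "infinity_coeff g 0 = smult c ([:-m, 1:] ^ total_degree g)" "total_degree g > 0"
    using infinity_coeff_0_eq[OF not01 m] regular_perfect_unique[OF reg m] by metis
  show ?thesis
  proof (cases "d = 1")
    case True
    then show ?thesis
      using infinity_series_agree_linear[OF \<phi> \<phi>' _ c(1,2) same] deg by simp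
  next
    case False
    then have d: "total_degree g \<ge> 2" using c(3) deg by simp
    show ?thesis
      using infinity_series_agree[OF \<phi> \<phi>' _ c(1,2) same d infinity_coeff_1_nonzero[OF reg m c(2) d]]
        deg by simp
  qed
qed

end
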